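(* For every $n \in \mathbb{N}$, \[ B(n) = \sum_{p \le n} p\, v_p(n!), \] where the sum runs over all primes $p \le n$ and \[ v_p(n!) = \sum_{k \ge 1} \left\lfloor \frac{n}{p^k} \right\rfloor . \]
   Context: $\mathbb{N}$ denotes the positive integers. For an integer $m \ge 2$ with prime factorization $m = \prod_p p^{\alpha_p}$, define $\mathrm{sopfr}(m) = \sum_p \alpha_p\, p$ (the sum of the prime factors of $m$, counted with multiplicity), and set $\mathrm{sopfr}(1) = 0$. The summatory function is $B(x) = \sum_{m \le x} \mathrm{sopfr}(m)$, the sum being over positive integers $m \le x$. For a prime $p$, $v_p(n!)$ denotes the $p$-adic valuation of $n!$, i.e. the exponent of $p$ in the prime factorization of $n!$. *)

theory Defs
  imports "HOL-Analysis.Infinite_Sum" "HOL-Computational_Algebra.Primes"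
begin

(* For m = 1 the sum is empty, which gives the convention sopfr 1 = 0. *)
definition sopfr :: "nat \<Rightarrow> nat" where
  "sopfr m = (\<Sum>p\<in>prime_factors m. multiplicity p m * p)"

definition sopfr_summatory :: "real \<Rightarrow> nat" where
  "sopfr_summatory x = (\<Sum>m | 0 < m \<and> real m \<le> x. sopfr m)"

end

theory Submission
  imports Defs
begin

text \<open>This is a double count. Summing \<open>multiplicity p m * p\<close> over all
  \<open>m\<close> up to \<open>n\<close> and all primes \<open>p\<close> up to \<open>n\<close>,
  and exchanging the two sums, leaves for each \<open>p\<close> the factor \<open>p\<close> times
  the sum of the multiplicities of \<open>p\<close> in 1, ..., n. By additivity of the valuation
  (\<open>multiplicity_fact\<close>) that sum is the exponent of \<open>p\<close> in
  \<open>fact n\<close>. The floor series is \<open>legendre_formula\<close>.\<close>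

lemma multiplicity_fact:
  fixes p n :: nat
  assumes "prime p"
  shows "multiplicity p (fact n) = (\<Sum>m = 1..n. multiplicity p m)"
  unfolding fact_prod using assms
  by (simp add: prime_elem_multiplicity_prod_distrib)

text \<open>The exponents \<open>k \<ge> 1\<close> with \<open>p ^ k dvd m\<close> are exactly 1,
  ..., \<open>multiplicity p m\<close>. None exceeds \<open>N\<close>, since
  \<open>2 ^ multiplicity p m \<le> m \<le> N\<close>.\<close>

lemma multiplicity_conv_sum:
  fixes p m N :: nat
  assumes "prime p" "0 < m" "m \<le> N"
  shows "multiplicity p m = (\<Sum>k = 1..N. of_bool (p ^ k dvd m))"
proof -
  have "2 ^ multiplicity p m \<le> p ^ multiplicity p m"
    using prime_ge_2_nat[OF assms(1)] by (intro power_mono) auto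
  also have "\<dots> \<le> m"
    using assms multiplicity_dvd by (intro dvd_imp_le) auto
  finally have "multiplicity p m \<le> N"
    using less_exp[of "multiplicity p m"] assms(3) by linarith
  then have "{1..N} \<inter> {k. p ^ k dvd m} = {1..multiplicity p m}"
    using assms prime_gt_1_nat[OF assms(1)] by (auto simp: power_dvd_iff_le_multiplicity)
  then show ?thesis
    by simp
qed

text \<open>The cutoff \<open>N\<close> is kept apart from \<open>n\<close> so that the range of
  \<open>k\<close> stays fixed during the induction on \<open>n\<close>.\<close>

lemma legendre_formula:
  fixes p n N :: nat
  assumes "prime p" "n \<le> N"
  shows "multiplicity p (fact n) = (\<Sum>k = 1..N. n div p ^ k)"
  using assms(2)
proof (induction n)
  case 0
  then show ?case by simp
next
  case (Suc n)
  \<comment> \<open>The quotient grows by one exactly when \<open>p ^ k\<close> divides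
    \<open>Suc n\<close>; over all \<open>k\<close> these increments add up to
    \<open>multiplicity p (Suc n)\<close>.\<close>
  have "Suc n div p ^ k = of_bool (p ^ k dvd Suc n) + n div p ^ k" for k
    by (simp add: div_Suc dvd_eq_mod_eq_0)
  then show ?case
    using Suc multiplicity_conv_sum[OF assms(1) _ Suc.prems]
      multiplicity_fact[OF assms(1)]
    by (simp add: sum.distrib del: fact_Suc)
qed

text \<open>Primes not dividing \<open>m\<close> contribute 0, so the index set can be made
  independent of \<open>m\<close>, as the exchange of sums requires.\<close>

lemma sopfr_conv_sum_primes_le:
  assumes "0 < m" "m \<le> n"
  shows "sopfr m = (\<Sum>p | prime p \<and> p \<le> n. multiplicity p m * p)"
  unfolding sopfr_def
proof (rule sum.mono_neutral_left)
  show "prime_factors m \<subseteq> {p. prime p \<and> p \<le> n}"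
    using assms by (auto simp: prime_factors_dvd dest: dvd_imp_le)
qed (auto simp: prime_factors_multiplicity)

theorem lemma3p1:
  fixes n :: nat
  assumes "n \<ge> 1"
  shows "sopfr_summatory (real n) = (\<Sum>p | prime p \<and> p \<le> n. p * multiplicity p (fact n))
    \<and> (\<forall>p::nat. prime p \<longrightarrow>
          ((\<lambda>k::nat. \<lfloor>real n / real p ^ k\<rfloor>) has_sum int (multiplicity p (fact n))) {1..})"
proof (intro conjI allI impI)
  have "{m. 0 < m \<and> real m \<le> real n} = {1..n}"
    by auto
  then have "sopfr_summatory (real n) = (\<Sum>m = 1..n. \<Sum>p | prime p \<and> p \<le> n. multiplicity p m * p)"
    by (simp add: sopfr_summatory_def sopfr_conv_sum_primes_le[of _ n])
  also have "\<dots> = (\<Sum>p | prime p \<and> p \<le> n. p * (\<Sum>m = 1..n. multiplicity p m))"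
    by (subst sum.swap) (simp add: sum_distrib_left mult.commute)
  also have "\<dots> = (\<Sum>p | prime p \<and> p \<le> n. p * multiplicity p (fact n))"
    by (simp add: multiplicity_fact)
  finally show "sopfr_summatory (real n) = \<dots>" .
next
  fix p :: nat
  assume p: "prime p"
  have floor_eq: "\<lfloor>real n / real p ^ k\<rfloor> = int (n div p ^ k)" for k
    using floor_divide_of_nat_eq[of n "p ^ k"] by simp
  \<comment> \<open>The series has only zero terms beyond \<open>k = n\<close>, so it reduces to the
    finite Legendre sum with cutoff \<open>N = n\<close>.\<close>
  have zero: "n div p ^ k = 0" if "n < k" for k
  proof -
    have "n < 2 ^ k"
      using that less_exp[of k] by linarith
    also have "\<dots> \<le> p ^ k"
      using prime_ge_2_nat[OF p] by (intro power_mono) auto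
    finally show ?thesis
      by simp
  qed
  have "((\<lambda>k. int (n div p ^ k)) has_sum (\<Sum>k = 1..n. int (n div p ^ k))) {1..}"
    by (rule has_sum_finite_neutralI) (auto simp: zero)
  then show "((\<lambda>k::nat. \<lfloor>real n / real p ^ k\<rfloor>) has_sum int (multiplicity p (fact n))) {1..}"
    by (simp add: floor_eq legendre_formula[OF p order_refl])
qed

end
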